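(* Let $t_0>0$, $c>0$, $\alpha>3$, $x_0,v_0\in\mathcal H$, and let $x:[t_0,+\infty[\to\mathcal H$ be the unique global solution of $$\ddot x(t)+\frac{\alpha}{t}\dot x(t)+\nabla f(x(t))+\frac{c}{t^2}x(t)=0,\qquad x(t_0)=x_0,\ \dot x(t_0)=v_0 .$$ Let $x^*$ be the element of minimal norm of $S=\operatorname{argmin} f$, that is, $x^*=\operatorname{proj}_S 0$. Then $$\liminf_{t\to+\infty}\|x(t)-x^*\|=0 .$$ Further, if there exists $T\ge t_0$ such that the trajectory $\{x(t):t\ge T\}$ stays either in the open ball $B(0,\|x^*\|)$ or in its complement, then $x(t)$ converges strongly to $x^*$ as $t\to+\infty$.
   Context: $\mathcal H$ is a real Hilbert space with scalar product $\langle\cdot,\cdot\rangle$ and norm $\|\cdot\|$. The function $f:\mathcal H\to\mathbb R$ is convex and differentiable, $\nabla f$ is Lipschitz continuous on bounded sets, and $S=\operatorname{argmin} f$ is nonempty. $B(0,\rho)=\{x\in\mathcal H:\|x\|<\rho\}$. Solutions are classical (twice differentiable) solutions on $[t_0,+\infty[$. *)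

theory Defs
  imports "HOL-Analysis.Analysis"
begin

definition argmin_set :: "('a \<Rightarrow> real) \<Rightarrow> 'a set" where
  "argmin_set f = {z. \<forall>y. f z \<le> f y}"

text \<open>
  Classical solutions on \<open>[t0, \<infinity>[\<close>: \<open>v\<close> and \<open>w\<close> are the first and second derivatives of \<open>x\<close>
  (one-sided at \<open>t0\<close>). The values of \<open>x\<close> on \<open>]-\<infinity>, t0[\<close> are irrelevant.
\<close>

definition tikhonov_avd_solution ::
    "('a::real_inner \<Rightarrow> 'a) \<Rightarrow> real \<Rightarrow> real \<Rightarrow> real \<Rightarrow> 'a \<Rightarrow> 'a \<Rightarrow> (real \<Rightarrow> 'a) \<Rightarrow> bool" where
  "tikhonov_avd_solution grad \<alpha> c t0 x0 v0 x \<longleftrightarrow>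
    (\<exists>v w. (\<forall>t\<ge>t0.
        (x has_vector_derivative v t) (at t within {t0..}) \<and>
        (v has_vector_derivative w t) (at t within {t0..}) \<and>
        w t + (\<alpha> / t) *\<^sub>R v t + grad (x t) + (c / t\<^sup>2) *\<^sub>R x t = 0) \<and>
      x t0 = x0 \<and> v t0 = v0)"

end

theory Submission
  imports Defs
begin

text \<open>
  The trajectory converges strongly to the minimum norm minimizer \<open>z = xs\<close>, and both
  assertions follow from that. Substituting \<open>s = ln t\<close> (so that the rescaled velocity is
  \<open>t x'\<close>) turns the equation into
  \<open>y'' + (\<alpha> - 1) y' + e\<^bsup>2s\<^esup> grad (y) + c y = 0\<close>, where damping and Tikhonov term have constant
  coefficients. One therefore looks for an energy \<open>E\<close> that contracts exponentially in \<open>s\<close>, that is,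
  polynomially in \<open>t\<close>, up to a small error. The choice is \<open>tikhonov_energy\<close> with a parameter
  \<open>2 < \<rho> < \<alpha> - 1\<close>; the condition \<open>\<alpha> > 3\<close> makes room for such a \<open>\<rho>\<close>.

  The only term of the energy that may be negative is \<open>(c/2) (\<parallel>x\<parallel>\<^sup>2 - \<parallel>z\<parallel>\<^sup>2)\<close>, and for the same reason
  the dissipation inequality has the form \<open>t E' \<le> - \<kappa> E + C g\<close>, where \<open>g\<close> is a bound for
  \<open>\<parallel>z\<parallel>\<^sup>2 - \<parallel>x\<parallel>\<^sup>2\<close> (lemma \<open>tikhonov_energy_dissipation\<close>). This inequality is used twice.

  With the crude bound \<open>g = \<parallel>z\<parallel>\<^sup>2\<close> it shows that \<open>E\<close> is bounded above, so that
  \<open>f (x t) - min f = O(1/t\<^sup>2)\<close>. Points with almost minimal value of \<open>f\<close> have norm at least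
  \<open>\<parallel>z\<parallel> - \<epsilon>\<close> (lemma \<open>norm_lower_bound_near_argmin\<close>), hence \<open>g\<close> can be taken arbitrarily small
  once \<open>t\<close> is large. The second use then gives \<open>limsup E \<le> 0\<close>. As the negative part of \<open>E\<close> tends
  to zero as well, the term \<open>\<parallel>x - z\<parallel>\<^sup>2\<close> of the energy must tend to zero.
\<close>

section \<open>Convex functions near their minimum norm minimizer\<close>

lemma convex_gradient_inequality:
  fixes f :: "'a::real_inner \<Rightarrow> real"
  assumes convex: "convex_on UNIV f" and gradient: "GDERIV f y :> g"
  shows "f y + inner g (z - y) \<le> f z"
proof -
  define \<phi> where "\<phi> \<theta> = f (y + \<theta> *\<^sub>R (z - y))" for \<theta> :: real
  have "convex_on UNIV \<phi>"
  proof (rule convex_onI)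
    fix t a b :: real assume t: "0 < t" "t < 1"
    have "y + ((1 - t) *\<^sub>R a + t *\<^sub>R b) *\<^sub>R (z - y) =
        (1 - t) *\<^sub>R (y + a *\<^sub>R (z - y)) + t *\<^sub>R (y + b *\<^sub>R (z - y))"
      by (simp add: algebra_simps)
    then show "\<phi> ((1 - t) *\<^sub>R a + t *\<^sub>R b) \<le> (1 - t) * \<phi> a + t * \<phi> b"
      unfolding \<phi>_def using convex_onD[OF convex, of t] t by simp
  qed simp
  moreover have "(\<phi> has_real_derivative inner g (z - y)) (at 0)"
  proof -
    have "((\<lambda>\<theta>::real. y + \<theta> *\<^sub>R (z - y)) has_derivative (\<lambda>\<theta>. \<theta> *\<^sub>R (z - y))) (at 0)"
      by (auto intro!: derivative_eq_intros)
    moreover have "(f has_derivative (\<lambda>h. inner h g)) (at (y + 0 *\<^sub>R (z - y)))"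
      using gradient by (simp add: gderiv_def)
    ultimately have "(\<phi> has_derivative (\<lambda>\<theta>. inner (\<theta> *\<^sub>R (z - y)) g)) (at 0)"
      unfolding \<phi>_def by (rule has_derivative_compose)
    then show ?thesis
      by (simp add: has_field_derivative_def inner_commute mult.commute[of _ "inner g (z - y)"])
  qed
  ultimately have "\<phi> 1 - \<phi> 0 \<ge> inner g (z - y) * (1 - 0)"
    by (intro convex_on_imp_above_tangent[where A = UNIV]) auto
  then show ?thesis by (simp add: \<phi>_def)
qed

text \<open>
  Bounded sequences need not have convergent subsequences in infinite dimension.
  However, nearly norm-minimal points of the decreasing convex sublevel sets
  \<open>{f \<le> min f + 1/(n+1)}\<close> form a Cauchy sequence by the parallelogram law, because midpoints
  of two of them are no shorter than the infimum. The limit is a minimizer of \<open>f\<close>; if every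
  sublevel set contained points shorter than \<open>\<parallel>z\<parallel> - \<epsilon>\<close>, the norm of the
  limit would be at most \<open>\<parallel>z\<parallel> - \<epsilon>\<close>, too small for a minimizer.
\<close>

lemma norm_lower_bound_near_argmin:
  fixes f :: "'a::{real_inner, complete_space} \<Rightarrow> real"
  assumes convex: "convex_on UNIV f" and cont: "continuous_on UNIV f"
    and z: "is_arg_min norm (\<lambda>z. z \<in> argmin_set f) z" and "\<epsilon> > 0"
  obtains \<delta> where "\<delta> > 0" "\<And>y. f y \<le> f z + \<delta> \<Longrightarrow> norm z - \<epsilon> \<le> norm y"
proof (rule ccontr)
  note \<delta>_thesis = that
  assume no_\<delta>: "\<not> thesis"
  have close: "\<exists>y. f y \<le> f z + \<delta> \<and> norm y < norm z - \<epsilon>" if "\<delta> > 0" for \<delta>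
  proof (rule ccontr)
    assume "\<not> ?thesis"
    then have "norm z - \<epsilon> \<le> norm y" if "f y \<le> f z + \<delta>" for y
      using that by (auto simp: not_less)
    with no_\<delta> \<delta>_thesis[OF \<open>\<delta> > 0\<close>] show False by blast
  qed
  have z_min: "f z \<le> f y" for y
    using z by (auto simp: is_arg_min_def argmin_set_def)
  define C where "C n = {y. f y \<le> f z + 1 / real (Suc n)}" for n
  define m where "m n = Inf (norm ` C n)" for n
  have bdd: "bdd_below (norm ` C n)" for n
    by (rule bdd_belowI[where m = 0]) auto
  have m_le: "m n \<le> norm y" if "y \<in> C n" for n y
    unfolding m_def using bdd that by (intro cInf_lower) auto
  have C_mono: "C k \<subseteq> C n" if "n \<le> k" for n k
  proof -
    have "1 / real (Suc k) \<le> 1 / real (Suc n)"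
      using that by (intro frac_le) auto
    then show ?thesis unfolding C_def by (auto simp del: of_nat_Suc)
  qed
  have C_ne: "norm ` C n \<noteq> {}" for n
    using close[of "1 / real (Suc n)"] by (auto simp: C_def)
  have m_mono: "incseq m"
    unfolding m_def by (intro incseq_SucI cInf_superset_mono C_ne bdd image_mono C_mono) auto
  have m_bound: "m n \<le> norm z - \<epsilon>" for n
    using close[of "1 / real (Suc n)"] m_le[of _ n] unfolding C_def by force
  obtain l where l: "m \<longlonglongrightarrow> l" "\<And>n. m n \<le> l"
    using incseq_convergent[OF m_mono, of "norm z - \<epsilon>"] m_bound by blast
  have l_bound: "l \<le> norm z - \<epsilon>"
    using l(1) m_bound by (intro LIMSEQ_le_const2) auto
  have "\<exists>y\<in>C n. norm y < m n + 1 / real (Suc n)" for n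
    using cInf_lessD[OF C_ne, of n "m n + 1 / real (Suc n)"] by (auto simp: m_def)
  then obtain Y where Y: "Y n \<in> C n" "norm (Y n) < m n + 1 / real (Suc n)" for n
    by metis
  define r where "r n = (l + 1 / real (Suc n))\<^sup>2 - (m n)\<^sup>2" for n
  have m_nonneg: "0 \<le> m n" for n
    unfolding m_def using C_ne by (intro cInf_greatest) auto
  have norm_Y: "(norm (Y k))\<^sup>2 \<le> (l + 1 / real (Suc n))\<^sup>2" if "n \<le> k" for n k
  proof (rule power_mono)
    have "1 / real (Suc k) \<le> 1 / real (Suc n)"
      using that by (intro frac_le) auto
    then show "norm (Y k) \<le> l + 1 / real (Suc n)"
      using Y(2)[of k] l(2)[of k] by linarith
  qed simp
  have diff: "(norm (Y n - Y k))\<^sup>2 \<le> 4 * r n" if "n \<le> k" for n k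
  proof -
    define p where "p = (1 - 1/2) *\<^sub>R Y n + (1/2) *\<^sub>R Y k"
    have "f p \<le> (1 - 1/2) * f (Y n) + (1/2) * f (Y k)"
      unfolding p_def by (rule convex_onD[OF convex]) auto
    then have "p \<in> C n"
      using Y(1)[of n] Y(1)[of k] C_mono[OF that] by (auto simp: C_def)
    then have "(m n)\<^sup>2 \<le> (norm p)\<^sup>2"
      by (intro power_mono m_le m_nonneg)
    moreover have "4 * (norm p)\<^sup>2 = (norm (Y n + Y k))\<^sup>2"
    proof -
      have "p = (1/2) *\<^sub>R (Y n + Y k)"
        by (simp add: p_def scaleR_add_right)
      then show ?thesis by (simp add: power_divide)
    qed
    moreover have "(norm (Y n - Y k))\<^sup>2 + (norm (Y n + Y k))\<^sup>2
        = 2 * (norm (Y n))\<^sup>2 + 2 * (norm (Y k))\<^sup>2"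
      unfolding power2_norm_eq_inner by (simp add: inner_add inner_diff inner_commute)
    ultimately show ?thesis
      using norm_Y[OF order_refl, of n] norm_Y[OF that] by (simp add: r_def)
  qed
  have "(\<lambda>n. 1 / real (Suc n)) \<longlonglongrightarrow> 0"
    using LIMSEQ_inverse_real_of_nat by (simp add: inverse_eq_divide)
  note inv_lim = this
  have "r \<longlonglongrightarrow> (l + 0)\<^sup>2 - l\<^sup>2"
    unfolding r_def by (intro tendsto_intros inv_lim l(1))
  then have r_lim: "r \<longlonglongrightarrow> 0" by simp
  have "Cauchy Y"
  proof (rule CauchyI')
    fix e :: real assume "e > 0"
    then have "\<forall>\<^sub>F n in sequentially. r n < e\<^sup>2 / 4"
      using r_lim by (intro order_tendstoD) auto
    then obtain M where M: "\<And>n. n \<ge> M \<Longrightarrow> r n < e\<^sup>2 / 4"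
      by (auto simp: eventually_sequentially)
    have "norm (Y n - Y k) < e" if "n \<ge> M" "k > n" for n k
    proof (rule power2_less_imp_less)
      show "(norm (Y n - Y k))\<^sup>2 < e\<^sup>2"
        using diff[of n k] M[of n] that by simp
    qed (use \<open>e > 0\<close> in simp)
    then show "\<exists>M. \<forall>n\<ge>M. \<forall>k>n. dist (Y n) (Y k) < e"
      unfolding dist_norm by blast
  qed
  then obtain p where p: "Y \<longlonglongrightarrow> p"
    using Cauchy_convergent convergent_def by blast
  have "(\<lambda>n. f (Y n)) \<longlonglongrightarrow> f p"
    using cont p by (intro continuous_on_tendsto_compose[OF cont]) auto
  moreover have "(\<lambda>n. f z + 1 / real (Suc n)) \<longlonglongrightarrow> f z + 0"
    by (intro tendsto_intros inv_lim)
  ultimately have "f p \<le> f z + 0"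
    by (rule LIMSEQ_le) (use Y(1) in \<open>auto simp: C_def\<close>)
  then have "p \<in> argmin_set f"
    unfolding argmin_set_def using z_min by (auto intro: order_trans)
  then have "norm z \<le> norm p"
    using z by (auto simp: is_arg_min_def not_less)
  moreover have "norm p \<le> l + 0"
    by (rule LIMSEQ_le[OF tendsto_norm[OF p] tendsto_add[OF l(1) inv_lim]])
      (use Y(2) in \<open>auto intro: less_imp_le\<close>)
  ultimately show False
    using l_bound \<open>\<epsilon> > 0\<close> by linarith
qed

section \<open>A decay estimate for differential inequalities\<close>

text \<open>
  The inequality \<open>t E' \<le> \<kappa> (\<eta> - E)\<close> says that \<open>t\<^bsup>\<kappa>\<^esup> (E - \<eta>)\<close> is nonincreasing, so \<open>E\<close> exceeds \<open>\<eta>\<close> by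
  at most a multiple of \<open>t\<^bsup>-\<kappa>\<^esup>\<close>.
\<close>

lemma eventually_le_of_decay_inequality:
  fixes E E' :: "real \<Rightarrow> real"
  assumes "T > 0" "\<kappa> > 0" "\<eta> < \<mu>"
    and deriv: "\<And>t. t \<ge> T \<Longrightarrow> (E has_real_derivative E' t) (at t)"
    and decay: "\<And>t. t \<ge> T \<Longrightarrow> t * E' t \<le> \<kappa> * (\<eta> - E t)"
  shows "\<forall>\<^sub>F t in at_top. E t \<le> \<mu>"
proof -
  define \<Phi> where "\<Phi> t = t powr \<kappa> * (E t - \<eta>)" for t
  have mono: "\<Phi> t \<le> \<Phi> T" if "T \<le> t" for t
  proof (rule DERIV_nonpos_imp_nonincreasing[OF that])
    fix s assume "T \<le> s" "s \<le> t"
    then have s: "s > 0" "s \<ge> T" using \<open>T > 0\<close> by auto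
    have "(\<Phi> has_real_derivative
        (\<kappa> * s powr (\<kappa> - 1) * (E s - \<eta>) + s powr \<kappa> * E' s)) (at s)"
      unfolding \<Phi>_def using s by (auto intro!: derivative_eq_intros deriv simp: field_simps)
    moreover have "\<kappa> * s powr (\<kappa> - 1) * (E s - \<eta>) + s powr \<kappa> * E' s
        = s powr (\<kappa> - 1) * (s * E' s - \<kappa> * (\<eta> - E s))"
      using s powr_mult_base[of s "\<kappa> - 1"] by (simp add: algebra_simps)
    moreover have "\<dots> \<le> 0"
      using decay[OF s(2)] by (intro mult_nonneg_nonpos) auto
    ultimately show "\<exists>y. (\<Phi> has_real_derivative y) (at s) \<and> y \<le> 0"
      by metis
  qed
  have "((\<lambda>t. \<Phi> T * t powr (- \<kappa>)) \<longlongrightarrow> \<Phi> T * 0) at_top"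
    using \<open>\<kappa> > 0\<close> by (intro tendsto_intros tendsto_neg_powr filterlim_ident) auto
  then have "\<forall>\<^sub>F t in at_top. \<Phi> T * t powr (- \<kappa>) < \<mu> - \<eta>"
    using \<open>\<eta> < \<mu>\<close> by (intro order_tendstoD) auto
  moreover have "\<forall>\<^sub>F t in at_top. t \<ge> T"
    by (rule eventually_ge_at_top)
  ultimately show ?thesis
  proof eventually_elim
    case (elim t)
    then have "t > 0" using \<open>T > 0\<close> by simp
    have "E t - \<eta> = \<Phi> t * t powr (- \<kappa>)"
      using \<open>t > 0\<close> by (simp add: \<Phi>_def powr_minus field_simps)
    also have "\<dots> \<le> \<Phi> T * t powr (- \<kappa>)"
      using mono[OF elim(2)] by (intro mult_right_mono) auto
    finally show ?case using elim(1) by simp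
  qed
qed

section \<open>The energy of a trajectory\<close>

text \<open>
  The argument \<open>\<beta>\<close> stands for \<open>\<alpha> - 1 - \<rho>\<close>; the coefficient of the last term makes the products
  \<open>\<langle>x - z, v\<rangle>\<close> cancel in the derivative.
\<close>

definition tikhonov_energy ::
    "('a::real_inner \<Rightarrow> real) \<Rightarrow> real \<Rightarrow> real \<Rightarrow> real \<Rightarrow> 'a \<Rightarrow> real \<Rightarrow> 'a \<Rightarrow> 'a \<Rightarrow> real" where
  "tikhonov_energy f c \<rho> \<beta> z t x v =
     t\<^sup>2 * (f x - f z) + c / 2 * ((norm x)\<^sup>2 - (norm z)\<^sup>2)
     + (norm (\<rho> *\<^sub>R (x - z) + t *\<^sub>R v))\<^sup>2 / 2 + \<rho> * \<beta> / 2 * (norm (x - z))\<^sup>2"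

lemma has_real_derivative_norm_square:
  fixes u :: "real \<Rightarrow> 'a::real_inner"
  assumes "(u has_vector_derivative u') (at t)"
  shows "((\<lambda>t. (norm (u t))\<^sup>2) has_real_derivative 2 * inner (u t) u') (at t)"
proof -
  note u' = assms[unfolded has_vector_derivative_def]
  have "((\<lambda>t. inner (u t) (u t)) has_derivative
      (\<lambda>h. inner (u t) (h *\<^sub>R u') + inner (h *\<^sub>R u') (u t))) (at t)"
    by (rule has_derivative_inner[OF u' u'])
  moreover have "(\<lambda>h. inner (u t) (h *\<^sub>R u') + inner (h *\<^sub>R u') (u t)) =
      (*) (2 * inner (u t) u')"
    by (simp add: fun_eq_iff inner_commute[of u'])
  ultimately show ?thesis
    by (simp add: has_field_derivative_def power2_norm_eq_inner)
qed

lemma tikhonov_energy_has_derivative: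
  fixes x v :: "real \<Rightarrow> 'a::real_inner"
  assumes gradient: "GDERIV f (x t) :> G"
    and x': "(x has_vector_derivative v t) (at t)"
    and v': "(v has_vector_derivative w) (at t)"
    and eq: "w + (\<alpha> / t) *\<^sub>R v t + G + (c / t\<^sup>2) *\<^sub>R x t = 0"
    and "t > 0" and \<beta>: "\<beta> = \<alpha> - 1 - \<rho>"
  shows "((\<lambda>t. tikhonov_energy f c \<rho> \<beta> z t (x t) (v t)) has_real_derivative
    (2 * t\<^sup>2 * (f (x t) - f z) - \<beta> * (norm (t *\<^sub>R v t))\<^sup>2
      - \<rho> * t\<^sup>2 * inner G (x t - z) - \<rho> * c * inner (x t) (x t - z)) / t) (at t)"
proof -
  have "(f has_derivative (\<lambda>h. inner h G)) (at (x t))"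
    using gradient by (simp add: gderiv_def)
  from has_derivative_compose[OF x'[unfolded has_vector_derivative_def] this]
  have f': "((\<lambda>t. f (x t)) has_real_derivative inner G (v t)) (at t)"
    by (simp add: has_field_derivative_def inner_commute mult.commute[of _ "inner G (v t)"])
  have w: "w = - ((\<alpha> / t) *\<^sub>R v t + G + (c / t\<^sup>2) *\<^sub>R x t)"
    using eq by (simp only: eq_neg_iff_add_eq_0 add.assoc)
  have d': "((\<lambda>t. x t - z) has_vector_derivative v t) (at t)"
    using has_vector_derivative_diff[OF x' has_vector_derivative_const[of z]] by simp
  have u': "((\<lambda>t. \<rho> *\<^sub>R (x t - z) + t *\<^sub>R v t) has_vector_derivative
      \<rho> *\<^sub>R v t + (t *\<^sub>R w + 1 *\<^sub>R v t)) (at t)"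
    by (intro has_vector_derivative_add has_vector_derivative_scaleR v' DERIV_ident
        bounded_linear.has_vector_derivative[OF bounded_linear_scaleR_right d'])
  define P where "P = (\<lambda>t. (norm (x t))\<^sup>2)"
  define Q where "Q = (\<lambda>t. (norm (\<rho> *\<^sub>R (x t - z) + t *\<^sub>R v t))\<^sup>2)"
  define R where "R = (\<lambda>t. (norm (x t - z))\<^sup>2)"
  note PQR' = has_real_derivative_norm_square[OF x', folded P_def]
    has_real_derivative_norm_square[OF u', folded Q_def]
    has_real_derivative_norm_square[OF d', folded R_def]
  have energy: "(\<lambda>t. tikhonov_energy f c \<rho> \<beta> z t (x t) (v t)) =
      (\<lambda>t. t\<^sup>2 * (f (x t) - f z) + c / 2 * (P t - (norm z)\<^sup>2) + Q t / 2 + \<rho> * \<beta> / 2 * R t)"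
    by (simp add: tikhonov_energy_def P_def Q_def R_def)
  define u where "u = \<rho> *\<^sub>R (x t - z) + t *\<^sub>R v t"
  have "((\<lambda>t. tikhonov_energy f c \<rho> \<beta> z t (x t) (v t)) has_real_derivative
      2 * t * (f (x t) - f z) + t\<^sup>2 * inner G (v t) + c * inner (x t) (v t)
      + inner u (\<rho> *\<^sub>R v t + (t *\<^sub>R w + 1 *\<^sub>R v t))
      + \<rho> * \<beta> * inner (x t - z) (v t)) (at t)"
    unfolding energy u_def
    by (auto intro!: derivative_eq_intros PQR' f')
  moreover have "2 * t * (f (x t) - f z) + t\<^sup>2 * inner G (v t) + c * inner (x t) (v t)
      + inner u (\<rho> *\<^sub>R v t + (t *\<^sub>R w + 1 *\<^sub>R v t))
      + \<rho> * \<beta> * inner (x t - z) (v t) =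
    (2 * t\<^sup>2 * (f (x t) - f z) - \<beta> * (norm (t *\<^sub>R v t))\<^sup>2
      - \<rho> * t\<^sup>2 * inner G (x t - z) - \<rho> * c * inner (x t) (x t - z)) / t"
  proof -
    have t: "t \<noteq> 0" using \<open>t > 0\<close> by simp
    have "\<rho> *\<^sub>R v t + (t *\<^sub>R w + 1 *\<^sub>R v t)
        = - (\<beta> *\<^sub>R v t + t *\<^sub>R G + (c / t) *\<^sub>R x t)"
      unfolding w \<beta> using t by (simp add: algebra_simps power2_eq_square)
    then have 1: "inner u (\<rho> *\<^sub>R v t + (t *\<^sub>R w + 1 *\<^sub>R v t)) =
        - (\<beta> * inner u (v t) + t * inner u G + c / t * inner u (x t))"
      by (simp add: inner_simps)
    have 2: "inner u y = \<rho> * inner (x t - z) y + t * inner (v t) y" for y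
      by (simp add: u_def inner_simps)
    have 3: "(norm (t *\<^sub>R v t))\<^sup>2 = t\<^sup>2 * inner (v t) (v t)"
      unfolding power2_norm_eq_inner by (simp add: power2_eq_square)
    show ?thesis
      unfolding 1
      unfolding 2 3 inner_commute[of G] inner_commute[of "x t" "v t"]
        inner_commute[of "x t" "x t - z"]
      using t by (simp add: field_simps power2_eq_square)
  qed
  ultimately show ?thesis
    by simp
qed

text \<open>
  Convexity bounds \<open>\<langle>G, x - z\<rangle>\<close> below by \<open>f x - f z\<close>, and
  \<open>2 \<langle>x, x - z\<rangle> = \<parallel>x - z\<parallel>\<^sup>2 + (\<parallel>x\<parallel>\<^sup>2 - \<parallel>z\<parallel>\<^sup>2)\<close>. As \<open>\<rho> > 2\<close> and \<open>\<beta> > 0\<close>, the derivative then contains a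
  negative multiple of every nonnegative term of the energy. In the term with
  \<open>\<parallel>x\<parallel>\<^sup>2 - \<parallel>z\<parallel>\<^sup>2\<close> the coefficient \<open>\<rho>\<close> exceeds \<open>\<kappa>\<close>, which costs a multiple of \<open>g\<close>.
  The last condition on \<open>\<kappa>\<close> comes from splitting the mixed term of the energy by
  \<open>\<parallel>a + b\<parallel>\<^sup>2 \<le> 2 \<parallel>a\<parallel>\<^sup>2 + 2 \<parallel>b\<parallel>\<^sup>2\<close>.
\<close>

lemma tikhonov_energy_dissipation:
  fixes x v z G :: "'a::real_inner"
  assumes convex: "convex_on UNIV f" and gradient: "GDERIV f x :> G"
    and z_min: "f z \<le> f x"
    and "c > 0" "\<rho> > 2" "\<kappa> > 0" "\<kappa> \<le> \<rho> - 2" "\<kappa> \<le> \<beta>"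
    and \<kappa>: "\<kappa> * (\<rho>\<^sup>2 + \<rho> * \<beta> / 2) \<le> \<rho> * c / 2"
    and g: "(norm z)\<^sup>2 - (norm x)\<^sup>2 \<le> g" "0 \<le> g"
  shows "2 * t\<^sup>2 * (f x - f z) - \<beta> * (norm (t *\<^sub>R v))\<^sup>2
      - \<rho> * t\<^sup>2 * inner G (x - z) - \<rho> * c * inner x (x - z)
    \<le> \<kappa> * (\<rho> * c * g / (2 * \<kappa>) - tikhonov_energy f c \<rho> \<beta> z t x v)"
proof -
  define F where "F = t\<^sup>2 * (f x - f z)"
  define V where "V = (norm (t *\<^sub>R v))\<^sup>2"
  define D where "D = (norm (x - z))\<^sup>2"
  define N where "N = (norm x)\<^sup>2 - (norm z)\<^sup>2"
  define U where "U = (norm (\<rho> *\<^sub>R (x - z) + t *\<^sub>R v))\<^sup>2"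
  have nonneg: "0 \<le> F" "0 \<le> V" "0 \<le> D"
    using z_min by (auto simp: F_def V_def D_def)
  have "f x - f z \<le> inner G (x - z)"
    using convex_gradient_inequality[OF convex gradient, of z] by (simp add: inner_diff_right)
  then have "F \<le> t\<^sup>2 * inner G (x - z)"
    unfolding F_def by (intro mult_left_mono) auto
  then have "\<rho> * F \<le> \<rho> * (t\<^sup>2 * inner G (x - z))"
    using \<open>\<rho> > 2\<close> by (intro mult_left_mono) auto
  then have 1: "\<rho> * F \<le> \<rho> * t\<^sup>2 * inner G (x - z)"
    by (simp add: mult.assoc)
  have 2: "inner x (x - z) = (D + N) / 2"
    unfolding D_def N_def power2_norm_eq_inner by (simp add: inner_simps inner_commute)
  have "U \<le> U + (norm (\<rho> *\<^sub>R (x - z) - t *\<^sub>R v))\<^sup>2"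
    by simp
  also have "\<dots> = 2 * (\<rho>\<^sup>2 * D + V)"
    unfolding U_def D_def V_def power2_norm_eq_inner
    by (simp add: inner_simps inner_commute algebra_simps power2_eq_square)
  finally have "\<kappa> * (U / 2) \<le> \<kappa> * (\<rho>\<^sup>2 * D + V)"
    using \<open>\<kappa> > 0\<close> by (intro mult_left_mono) auto
  then have 3: "\<kappa> * (U / 2) \<le> \<kappa> * \<rho>\<^sup>2 * D + \<kappa> * V"
    by (simp add: algebra_simps)
  have 4: "\<kappa> * F \<le> (\<rho> - 2) * F" "\<kappa> * V \<le> \<beta> * V"
    using assms nonneg by (auto intro: mult_right_mono)
  have 5: "\<kappa> * (\<rho>\<^sup>2 + \<rho> * \<beta> / 2) * D \<le> \<rho> * c / 2 * D"
    using \<kappa> nonneg by (intro mult_right_mono)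
  have "(\<rho> - \<kappa>) * c / 2 * (- N) \<le> (\<rho> - \<kappa>) * c / 2 * g"
    using assms by (intro mult_left_mono) (auto simp: N_def)
  also have "\<dots> \<le> \<rho> * c / 2 * g"
    using assms by (intro mult_right_mono) auto
  finally have 6: "(\<rho> - \<kappa>) * c / 2 * (- N) \<le> \<rho> * c / 2 * g" .
  have energy: "\<kappa> * (\<rho> * c * g / (2 * \<kappa>) - tikhonov_energy f c \<rho> \<beta> z t x v) =
      \<rho> * c / 2 * g - \<kappa> * F - \<kappa> * c / 2 * N - \<kappa> * (U / 2) - \<kappa> * (\<rho> * \<beta> / 2) * D"
    using \<open>\<kappa> > 0\<close>
    unfolding tikhonov_energy_def F_def[symmetric] N_def[symmetric] U_def[symmetric]
      D_def[symmetric]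
    by (simp add: algebra_simps)
  have "2 * F - \<beta> * V - \<rho> * F - \<rho> * c * ((D + N) / 2)
      \<le> \<rho> * c / 2 * g - \<kappa> * F - \<kappa> * c / 2 * N - \<kappa> * (U / 2) - \<kappa> * (\<rho> * \<beta> / 2) * D"
    using 3 4 5 6 by (simp add: algebra_simps add_divide_distrib diff_divide_distrib)
  moreover have "2 * t\<^sup>2 * (f x - f z) = 2 * F"
    by (simp add: F_def)
  ultimately show ?thesis
    using 1 unfolding energy 2 V_def[symmetric] by linarith
qed

section \<open>Strong convergence\<close>

lemma tikhonov_avd_tendsto_min_norm_minimizer:
  fixes f :: "'a::{real_inner, complete_space} \<Rightarrow> real"
  assumes convex: "convex_on UNIV f"
    and gradient: "\<And>z. GDERIV f z :> grad z"
    and "t0 > 0" "c > 0" "\<alpha> > 3"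
    and solution: "tikhonov_avd_solution grad \<alpha> c t0 x0 v0 x"
    and min_norm: "is_arg_min norm (\<lambda>z. z \<in> argmin_set f) z"
  shows "(x \<longlongrightarrow> z) at_top"
proof -
  obtain v w where sol: "\<And>t. t \<ge> t0 \<Longrightarrow>
        (x has_vector_derivative v t) (at t within {t0..}) \<and>
        (v has_vector_derivative w t) (at t within {t0..}) \<and>
        w t + (\<alpha> / t) *\<^sub>R v t + grad (x t) + (c / t\<^sup>2) *\<^sub>R x t = 0"
    using solution unfolding tikhonov_avd_solution_def by blast
  have within: "at t within {t0..} = at t" if "t > t0" for t
    using that by (intro at_within_interior) auto
  have z_min: "f z \<le> f y" for y
    using min_norm by (auto simp: is_arg_min_def argmin_set_def)
  have cont: "continuous_on UNIV f"
    using has_derivative_continuous[OF gradient[unfolded gderiv_def]]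
    by (simp add: continuous_on_eq_continuous_at)
  define \<rho> where "\<rho> = (\<alpha> + 1) / 2"
  define \<beta> where "\<beta> = \<alpha> - 1 - \<rho>"
  have \<rho>: "\<rho> > 2" and \<beta>: "\<beta> > 0"
    using \<open>\<alpha> > 3\<close> by (auto simp: \<rho>_def \<beta>_def field_simps)
  have q: "\<rho>\<^sup>2 + \<rho> * \<beta> / 2 > 0"
    using \<rho> \<beta> by (intro add_pos_pos) auto
  define \<kappa> where "\<kappa> = min (min (\<rho> - 2) \<beta>) (\<rho> * c / 2 / (\<rho>\<^sup>2 + \<rho> * \<beta> / 2))"
  have "\<kappa> > 0"
    using \<rho> \<beta> q \<open>c > 0\<close> by (auto simp: \<kappa>_def)
  have \<kappa>_le: "\<kappa> \<le> \<rho> - 2" "\<kappa> \<le> \<beta>"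
    by (auto simp: \<kappa>_def)
  have "\<kappa> \<le> \<rho> * c / 2 / (\<rho>\<^sup>2 + \<rho> * \<beta> / 2)"
    unfolding \<kappa>_def by simp
  then have \<kappa>_c: "\<kappa> * (\<rho>\<^sup>2 + \<rho> * \<beta> / 2) \<le> \<rho> * c / 2"
    using q by (simp only: pos_le_divide_eq)
  define E where "E t = tikhonov_energy f c \<rho> \<beta> z t (x t) (v t)" for t

  have bound: "\<forall>\<^sub>F t in at_top. E t \<le> \<mu>"
    if small: "\<forall>\<^sub>F t in at_top. (norm z)\<^sup>2 - (norm (x t))\<^sup>2 \<le> g" and "0 \<le> g"
      and \<mu>: "\<rho> * c * g / (2 * \<kappa>) < \<mu>" for g \<mu>
  proof -
    obtain T0 where T0: "\<And>t. t \<ge> T0 \<Longrightarrow> (norm z)\<^sup>2 - (norm (x t))\<^sup>2 \<le> g"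
      using small by (auto simp: eventually_at_top_linorder)
    define T where "T = max T0 (t0 + 1)"
    define E' where "E' t = (2 * t\<^sup>2 * (f (x t) - f z) - \<beta> * (norm (t *\<^sub>R v t))\<^sup>2
      - \<rho> * t\<^sup>2 * inner (grad (x t)) (x t - z) - \<rho> * c * inner (x t) (x t - z)) / t" for t
    show ?thesis
    proof (rule eventually_le_of_decay_inequality[where E' = E', OF _ \<open>\<kappa> > 0\<close> \<mu>])
      show "T > 0" using \<open>t0 > 0\<close> by (simp add: T_def)
      fix t assume "t \<ge> T"
      then have t: "t > t0" "t \<ge> T0" "t > 0" using \<open>t0 > 0\<close> by (auto simp: T_def)
      show "(E has_real_derivative E' t) (at t)"
        unfolding E_def E'_def using sol[of t] t within[OF t(1)]
        by (intro tikhonov_energy_has_derivative[where \<alpha> = \<alpha> and w = "w t"] gradient)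
          (auto simp: \<beta>_def)
      have "t * E' t = 2 * t\<^sup>2 * (f (x t) - f z) - \<beta> * (norm (t *\<^sub>R v t))\<^sup>2
          - \<rho> * t\<^sup>2 * inner (grad (x t)) (x t - z) - \<rho> * c * inner (x t) (x t - z)"
        unfolding E'_def using t by simp
      also have "\<dots> \<le> \<kappa> * (\<rho> * c * g / (2 * \<kappa>) - E t)"
        unfolding E_def by (intro tikhonov_energy_dissipation convex gradient z_min
            \<open>c > 0\<close> \<rho> \<open>\<kappa> > 0\<close> \<kappa>_le \<kappa>_c T0 t \<open>0 \<le> g\<close>)
      finally show "t * E' t \<le> \<kappa> * (\<rho> * c * g / (2 * \<kappa>) - E t)" .
    qed
  qed

  \<comment> \<open>No information on the norm of \<open>x t\<close> is available yet, so \<open>g = \<parallel>z\<parallel>\<^sup>2\<close> is used first.\<close>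
  define K where "K = \<rho> * c * (norm z)\<^sup>2 / (2 * \<kappa>) + 1"
  have E_K: "\<forall>\<^sub>F t in at_top. E t \<le> K"
    by (rule bound[where g = "(norm z)\<^sup>2"]) (auto simp: K_def)
  have value_bound: "\<forall>\<^sub>F t in at_top. f (x t) \<le> f z + \<delta>" if "\<delta> > 0" for \<delta>
  proof -
    define M where "M = K + c / 2 * (norm z)\<^sup>2"
    have "((\<lambda>t. M / t\<^sup>2) \<longlongrightarrow> 0) at_top"
      by (intro tendsto_divide_0[OF tendsto_const] filterlim_at_top_imp_at_infinity
          filterlim_pow_at_top filterlim_ident) simp
    then have "\<forall>\<^sub>F t in at_top. M / t\<^sup>2 < \<delta>"
      using that by (rule order_tendstoD)
    then show ?thesis
      using E_K eventually_gt_at_top[of 0]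
    proof eventually_elim
      case (elim t)
      have "0 \<le> c / 2 * (norm (x t))\<^sup>2" "0 \<le> \<rho> * \<beta> / 2 * (norm (x t - z))\<^sup>2"
        using \<open>c > 0\<close> \<rho> \<beta> by auto
      moreover have "0 \<le> (norm (\<rho> *\<^sub>R (x t - z) + t *\<^sub>R v t))\<^sup>2 / 2"
        by simp
      ultimately have "t\<^sup>2 * (f (x t) - f z) \<le> M"
        using elim(2) unfolding E_def tikhonov_energy_def M_def right_diff_distrib by linarith
      then have "f (x t) - f z \<le> M / t\<^sup>2"
        using \<open>t > 0\<close> by (simp add: pos_le_divide_eq mult.commute)
      then show ?case using elim(1) by simp
    qed
  qed

  have norms: "\<forall>\<^sub>F t in at_top. (norm z)\<^sup>2 - (norm (x t))\<^sup>2 \<le> g" if "g > 0" for g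
  proof -
    define \<epsilon> where "\<epsilon> = g / (2 * norm z + 1)"
    have "\<epsilon> > 0" using that by (auto simp: \<epsilon>_def intro!: divide_pos_pos add_nonneg_pos)
    then obtain \<delta> where \<delta>: "\<delta> > 0" "\<And>y. f y \<le> f z + \<delta> \<Longrightarrow> norm z - \<epsilon> \<le> norm y"
      using norm_lower_bound_near_argmin[OF convex cont min_norm] by metis
    show ?thesis
      using value_bound[OF \<delta>(1)]
    proof eventually_elim
      case (elim t)
      then have "norm z - \<epsilon> \<le> norm (x t)" by (rule \<delta>(2))
      show ?case
      proof (cases "norm z \<le> norm (x t)")
        case True
        then show ?thesis using power_mono[OF True norm_ge_zero, of 2] that by linarith
      next
        case False
        have "(norm z)\<^sup>2 - (norm (x t))\<^sup>2 = (norm z - norm (x t)) * (norm z + norm (x t))"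
          by (simp add: power2_eq_square algebra_simps)
        also have "\<dots> \<le> \<epsilon> * (2 * norm z + 1)"
          using False \<open>norm z - \<epsilon> \<le> norm (x t)\<close> by (intro mult_mono) auto
        also have "\<dots> = g" by (simp add: \<epsilon>_def add_nonneg_eq_0_iff)
        finally show ?thesis .
      qed
    qed
  qed

  have "((\<lambda>t. (norm (x t - z))\<^sup>2) \<longlongrightarrow> 0) at_top"
  proof (rule order_tendstoI)
    fix e :: real assume "0 < e"
    define \<gamma> where "\<gamma> = \<rho> * \<beta> / 2"
    define \<eta> where "\<eta> = \<gamma> * e"
    have "\<gamma> > 0" using \<rho> \<beta> by (simp add: \<gamma>_def)
    then have "\<eta> > 0" using \<open>0 < e\<close> by (simp add: \<eta>_def)
    \<comment> \<open>Half of \<open>\<eta>\<close> bounds the energy, a quarter its possibly negative term.\<close>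
    define g where "g = min (\<kappa> * \<eta> / (2 * \<rho> * c)) (\<eta> / (2 * c))"
    have "g > 0" using \<open>\<eta> > 0\<close> \<open>\<kappa> > 0\<close> \<open>c > 0\<close> \<rho> by (simp add: g_def)
    have g1: "\<rho> * c * g / (2 * \<kappa>) < \<eta> / 2"
    proof -
      have "g \<le> \<kappa> * \<eta> / (2 * \<rho> * c)" by (simp add: g_def)
      then have "\<rho> * c * g \<le> \<kappa> * \<eta> / 2"
        using \<rho> \<open>c > 0\<close> by (simp add: field_simps)
      then have "\<rho> * c * g < \<kappa> * \<eta>"
        using \<open>\<kappa> > 0\<close> \<open>\<eta> > 0\<close> mult_pos_pos[of \<kappa> \<eta>] by linarith
      then show ?thesis using \<open>\<kappa> > 0\<close> by (simp add: field_simps)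
    qed
    have g2: "c / 2 * g \<le> \<eta> / 4"
    proof -
      have "g \<le> \<eta> / (2 * c)" by (simp add: g_def)
      then show ?thesis using \<open>c > 0\<close> by (simp add: field_simps)
    qed
    show "\<forall>\<^sub>F t in at_top. (norm (x t - z))\<^sup>2 < e"
      using bound[OF norms[OF \<open>g > 0\<close>] less_imp_le[OF \<open>g > 0\<close>] g1] norms[OF \<open>g > 0\<close>]
    proof eventually_elim
      case (elim t)
      have "c / 2 * ((norm z)\<^sup>2 - (norm (x t))\<^sup>2) \<le> c / 2 * g"
        using elim(2) \<open>c > 0\<close> by (intro mult_left_mono) auto
      then have "c / 2 * ((norm (x t))\<^sup>2 - (norm z)\<^sup>2) \<ge> - \<eta> / 4"
        using g2 by (simp add: algebra_simps)
      moreover have "0 \<le> t\<^sup>2 * (f (x t) - f z)"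
        using z_min[of "x t"] by simp
      moreover have "0 \<le> (norm (\<rho> *\<^sub>R (x t - z) + t *\<^sub>R v t))\<^sup>2 / 2"
        by simp
      ultimately have "\<gamma> * (norm (x t - z))\<^sup>2 < \<gamma> * e"
        using elim(1) \<open>\<eta> > 0\<close>
        unfolding E_def tikhonov_energy_def \<gamma>_def[symmetric] \<eta>_def[symmetric] by linarith
      then show ?case using \<open>\<gamma> > 0\<close> by simp
    qed
  next
    fix e :: real assume "e < 0"
    then show "\<forall>\<^sub>F t in at_top. e < (norm (x t - z))\<^sup>2"
      by (intro always_eventually allI) (rule less_le_trans, auto)
  qed
  from tendsto_real_sqrt[OF this] have "((\<lambda>t. norm (x t - z)) \<longlongrightarrow> 0) at_top"
    by simp
  then show ?thesis
    using LIM_zero_cancel tendsto_norm_zero_iff by blast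
qed

theorem theorem9:
  fixes f :: "'a::{real_inner, complete_space} \<Rightarrow> real"
    and grad :: "'a \<Rightarrow> 'a"
    and t0 c \<alpha> :: real
    and x0 v0 xs :: 'a
    and x :: "real \<Rightarrow> 'a"
  assumes convex: "convex_on UNIV f"
    and gradient: "\<And>z. GDERIV f z :> grad z"
    and lipschitz: "\<And>B. bounded B \<Longrightarrow> \<exists>L. L-lipschitz_on B grad"
    and nonempty: "argmin_set f \<noteq> {}"
    and "t0 > 0" and "c > 0" and "\<alpha> > 3"
    and solution: "tikhonov_avd_solution grad \<alpha> c t0 x0 v0 x"
    and min_norm: "is_arg_min norm (\<lambda>z. z \<in> argmin_set f) xs"
  shows "Liminf at_top (\<lambda>t. ereal (norm (x t - xs))) = 0 \<and>
    ((\<exists>T\<ge>t0. x ` {T..} \<subseteq> ball 0 (norm xs) \<or> x ` {T..} \<subseteq> - ball 0 (norm xs))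
      \<longrightarrow> (x \<longlongrightarrow> xs) at_top)"
proof -
  have lim: "(x \<longlongrightarrow> xs) at_top"
    by (rule tikhonov_avd_tendsto_min_norm_minimizer[OF convex gradient
          \<open>t0 > 0\<close> \<open>c > 0\<close> \<open>\<alpha> > 3\<close> solution min_norm])
  then have "((\<lambda>t. norm (x t - xs)) \<longlongrightarrow> 0) at_top"
    using LIM_zero tendsto_norm_zero by blast
  then have "((\<lambda>t. ereal (norm (x t - xs))) \<longlongrightarrow> 0) at_top"
    by (simp add: zero_ereal_def)
  then have "Liminf at_top (\<lambda>t. ereal (norm (x t - xs))) = 0"
    by (intro lim_imp_Liminf) auto
  with lim show ?thesis by blast
qed

end
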